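(* Let $T\ge 1$, let $\sigma_1^2,\ldots,\sigma_T^2>0$, and let $\boldsymbol{\varepsilon}=(\varepsilon_1,\ldots,\varepsilon_T)'\sim E_T\left(\mathbf{0},\mathrm{diag}(\sigma_1^2,\ldots,\sigma_T^2),h\right)$. Then the likelihood of $\boldsymbol{\varepsilon}$, representing a probabilistic dependent sample, is $$L\left(\boldsymbol{\varepsilon}\mid\sigma_1^2,\ldots,\sigma_T^2\right)=\frac{c_T}{\left(\prod_{t=1}^T\sigma_t^2\right)^{1/2}}\,h\left(\sum_{t=1}^T\frac{\varepsilon_t^2}{\sigma_t^2}\right).\qquad (\mathrm{D})$$ The classical likelihood based on a probabilistic independent sample, i.e. when $\varepsilon_1,\ldots,\varepsilon_T$ are instead independent with $\varepsilon_t\sim E_1(0,\sigma_t^2,h)$ for each $t$, is $$L\left(\varepsilon_1,\ldots,\varepsilon_T\mid\sigma_1^2,\ldots,\sigma_T^2\right)=\frac{c_1^T}{\left(\prod_{t=1}^T\sigma_t^2\right)^{1/2}}\prod_{t=1}^T h\left(\frac{\varepsilon_t^2}{\sigma_t^2}\right).\qquad (\mathrm{I})$$ Moreover, given the Ar(k) law for the mean with parameters $\beta_0,\ldots,\beta_k$, that is $\varepsilon_t=y_t-(1,x_{1,t},\ldots,x_{k,t})(\beta_0,\beta_1,\ldots,\beta_k)'$, the volatility model for the variance $\sigma_t^2$, $t=1,\ldots,T$, takes the following forms, and in each case the logarithms of (D) and (I) are the objective functions to be maximized in terms of the indicated parameters: (1) Arch(p): the $k+1+p+1$ parameters are $\beta_0,\ldots,\beta_k,\alpha_0,\ldots,\alpha_p$,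 where $$\sigma_t^2=\alpha_0+\sum_{i=1}^p\alpha_i\varepsilon_{t-i}^2.$$ (2) Garch(p,q): the $k+1+p+1+q$ parameters are $\beta_0,\ldots,\beta_k,\alpha_0,\ldots,\alpha_p,\gamma_1,\ldots,\gamma_q$, where $$\sigma_t^2=\alpha_0+\sum_{i=1}^p\alpha_i\varepsilon_{t-i}^2+\sum_{i=1}^q\gamma_i\sigma_{t-i}^2.$$ (3) Tgarch(p,q): the $k+1+p+1+q+p$ parameters are $\beta_0,\ldots,\beta_k,\alpha_0,\ldots,\alpha_p,\gamma_1,\ldots,\gamma_q,\delta_1,\ldots,\delta_p$, where $$\sigma_t^2=\alpha_0+\sum_{i=1}^p\alpha_i\varepsilon_{t-i}^2+\sum_{i=1}^q\gamma_i\sigma_{t-i}^2+\sum_{i=1}^p\delta_iN_{t-i}\varepsilon_{t-i}^2,$$ with $N_{t-i}=1$ if $\varepsilon_{t-i}<0$ and $N_{t-i}=0$ if $\varepsilon_{t-i}\ge 0$. (4) Egarch(p,q): the $k+1+p+1+q+p$ parameters are $\beta_0,\ldots,\beta_k,\alpha_0,\ldots,\alpha_p,\gamma_1,\ldots,\gamma_q,\delta_1,\ldots,\delta_p$, where $$\sigma_t^2=\exp\left[\alpha_0+\sum_{i=1}^p\alpha_i\left(\left|\frac{\varepsilon_{t-i}}{\sigma_{t-i}}\right|-E(h)\right)+\sum_{i=1}^q\gamma_i\frac{\varepsilon_{t-i}}{\sigma_{t-i}}+\sum_{i=1}^p\delta_i\log\sigma_{t-i}^2\right],$$ and $E(h)$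 is a constant depending on the elliptical model $h$.
   Context: For a positive integer $m$, $\boldsymbol{\mu}\in\mathbb{R}^m$ and a positive definite $m\times m$ matrix $\boldsymbol{\Sigma}$, a random vector $\mathbf{y}\in\mathbb{R}^m$ has the elliptically contoured distribution $E_m(\boldsymbol{\mu},\boldsymbol{\Sigma},h)$ if it has density with respect to Lebesgue measure $$f_{\mathbf{y}}(\mathbf{y})=c_m|\boldsymbol{\Sigma}|^{-1/2}h\left[(\mathbf{y}-\boldsymbol{\mu})'\boldsymbol{\Sigma}^{-1}(\mathbf{y}-\boldsymbol{\mu})\right],\qquad \mathbf{y}\in\mathbb{R}^m,$$ where $|\boldsymbol{\Sigma}|$ is the determinant, the prime denotes transpose, the generator $h$ is a nonnegative function with $\int_0^\infty v^{m-1}h(v^2)\,dv<\infty$, and $c_m$ is the normalization constant for which $\int_{\mathbb{R}^m}f_{\mathbf{y}}(\mathbf{y})\,d\mathbf{y}=1$. In the univariate case $m=1$, with $\boldsymbol{\Sigma}=\sigma^2>0$, the density is $c_1(\sigma^2)^{-1/2}h\left[(y-\mu)^2/\sigma^2\right]$, with $\int_0^\infty h(v^2)\,dv<\infty$. The integrability condition is assumed for $m=T$ in the dependent likelihood and for $m=1$ in the independent likelihood. The likelihood of a sample is its joint density viewed as a function of the parameters. In the time series setting, $y_t$ is the variable measured at time $t$, $x_{1,t},\ldots,x_{k,t}$ are the regressors (in the autoregressive Ar(k) case, past values of the series), $\beta_0,\ldots,\beta_k$ are the mean parameters, $\varepsilon_t$ is the error, and $\sigma_t^2$ is its (conditional)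 scale parameter, called the variance or volatility. The information on the past records needed to evaluate the lagged terms is regarded as available. Parameter values are such that $\sigma_t^2>0$. *)

theory Defs
  imports "HOL-Probability.Probability"
begin

section \<open>Elliptically contoured distributions\<close>

text \<open>Only the values of \<open>h\<close> on \<open>[0, \<infinity>)\<close> matter. Borel measurability of \<open>h\<close> there is implied
  by the integrability condition.\<close>

definition generator :: "nat \<Rightarrow> (real \<Rightarrow> real) \<Rightarrow> bool" where
  "generator m h \<longleftrightarrow> (\<forall>u\<ge>0. 0 \<le> h u) \<and> set_integrable lborel {0..} (\<lambda>v. v ^ (m - 1) * h (v\<^sup>2))"

definition pos_def :: "real^'n^'n \<Rightarrow> bool" where
  "pos_def A \<longleftrightarrow> transpose A = A \<and> (\<forall>x. x \<noteq> 0 \<longrightarrow> 0 < x \<bullet> (A *v x))"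

definition diag_matrix :: "real^'n \<Rightarrow> real^'n^'n" where
  "diag_matrix d = (\<chi> i j. if i = j then d $ i else 0)"

definition elliptical_density ::
    "real \<Rightarrow> real^'n \<Rightarrow> real^'n^'n \<Rightarrow> (real \<Rightarrow> real) \<Rightarrow> real^'n \<Rightarrow> real" where
  "elliptical_density c \<mu> \<Sigma> h y =
     c * det \<Sigma> powr (-1/2) * h ((y - \<mu>) \<bullet> (matrix_inv \<Sigma> *v (y - \<mu>)))"

text \<open>The normalization constant depends on the dimension and on \<open>h\<close> only, so one \<open>c\<close> has to serve
  all \<open>\<mu>\<close> and \<open>\<Sigma>\<close>; it is unique when it exists. A non-integrable function has integral 0,
  so integral 1 includes integrability.\<close>

definition normalizing_const :: "'n::finite itself \<Rightarrow> (real \<Rightarrow> real) \<Rightarrow> real \<Rightarrow> bool" where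
  "normalizing_const _ h c \<longleftrightarrow>
     (\<forall>(\<mu> :: real^'n) \<Sigma>. pos_def \<Sigma> \<longrightarrow> (\<integral>y. elliptical_density c \<mu> \<Sigma> h y \<partial>lborel) = 1)"

definition elliptical ::
    "'a measure \<Rightarrow> ('a \<Rightarrow> real^'n) \<Rightarrow> real^'n \<Rightarrow> real^'n^'n \<Rightarrow> (real \<Rightarrow> real) \<Rightarrow> bool" where
  "elliptical M X \<mu> \<Sigma> h \<longleftrightarrow>
     pos_def \<Sigma> \<and> generator CARD('n) h \<and>
     (\<exists>c. normalizing_const TYPE('n) h c \<and>
          distributed M lborel X (\<lambda>y. ennreal (elliptical_density c \<mu> \<Sigma> h y)))"

text \<open>The univariate case, for real-valued instead of \<open>real^1\<close>-valued random variables;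
  \<open>s\<close> is the squared scale.\<close>

definition elliptical_density1 :: "real \<Rightarrow> real \<Rightarrow> real \<Rightarrow> (real \<Rightarrow> real) \<Rightarrow> real \<Rightarrow> real" where
  "elliptical_density1 c \<mu> s h y = c * s powr (-1/2) * h ((y - \<mu>)\<^sup>2 / s)"

definition normalizing_const1 :: "(real \<Rightarrow> real) \<Rightarrow> real \<Rightarrow> bool" where
  "normalizing_const1 h c \<longleftrightarrow>
     (\<forall>\<mu> s. 0 < s \<longrightarrow> (\<integral>y. elliptical_density1 c \<mu> s h y \<partial>lborel) = 1)"

definition elliptical1 :: "'a measure \<Rightarrow> ('a \<Rightarrow> real) \<Rightarrow> real \<Rightarrow> real \<Rightarrow> (real \<Rightarrow> real) \<Rightarrow> bool" where
  "elliptical1 M X \<mu> s h \<longleftrightarrow>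
     0 < s \<and> generator 1 h \<and>
     (\<exists>c. normalizing_const1 h c \<and>
          distributed M lborel X (\<lambda>y. ennreal (elliptical_density1 c \<mu> s h y)))"


section \<open>Maximum likelihood\<close>

text \<open>A likelihood may vanish where \<open>h\<close> does, so its logarithm takes values in \<open>[-\<infinity>, \<infinity>)\<close>.\<close>

definition log_ext :: "real \<Rightarrow> ereal" where
  "log_ext u = (if u \<le> 0 then -\<infinity> else ereal (ln u))"

text \<open>\<open>g\<close> is the log-likelihood belonging to the likelihood function \<open>L\<close> on the parameter set
  \<open>\<Theta>\<close>, and maximum likelihood estimation over \<open>\<Theta>\<close> amounts to maximizing \<open>g\<close>.\<close>

definition objective_function :: "'p set \<Rightarrow> ('p \<Rightarrow> real) \<Rightarrow> ('p \<Rightarrow> ereal) \<Rightarrow> bool" where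
  "objective_function \<Theta> L g \<longleftrightarrow>
     (\<forall>\<theta>\<in>\<Theta>. g \<theta> = log_ext (L \<theta>)) \<and>
     (\<forall>\<theta>. is_arg_max L (\<lambda>\<theta>. \<theta> \<in> \<Theta>) \<theta> \<longleftrightarrow> is_arg_max g (\<lambda>\<theta>. \<theta> \<in> \<Theta>) \<theta>)"


section \<open>Volatility models\<close>

text \<open>Names of the real parameters. A parameter vector of a model is an extensional function on the
  finite set of parameter names of that model.\<close>

datatype param = \<beta> nat | \<alpha> nat | \<gamma> nat | \<delta> nat

definition arch_params :: "nat \<Rightarrow> nat \<Rightarrow> param set" where
  "arch_params k p = \<beta> ` {0..k} \<union> \<alpha> ` {0..p}"

definition garch_params :: "nat \<Rightarrow> nat \<Rightarrow> nat \<Rightarrow> param set" where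
  "garch_params k p q = \<beta> ` {0..k} \<union> \<alpha> ` {0..p} \<union> \<gamma> ` {1..q}"

definition tgarch_params :: "nat \<Rightarrow> nat \<Rightarrow> nat \<Rightarrow> param set" where
  "tgarch_params k p q = \<beta> ` {0..k} \<union> \<alpha> ` {0..p} \<union> \<gamma> ` {1..q} \<union> \<delta> ` {1..p}"

abbreviation (input) egarch_params :: "nat \<Rightarrow> nat \<Rightarrow> nat \<Rightarrow> param set" where
  "egarch_params \<equiv> tgarch_params"

text \<open>Time is an integer; the sample is observed at times \<open>1, \<dots>, T\<close>, and times \<open>\<le> 0\<close> carry the past
  records needed for the lagged terms. \<open>x j t\<close> is the \<open>j\<close>-th regressor at time \<open>t\<close>.\<close>

definition ar_error ::
    "(int \<Rightarrow> real) \<Rightarrow> (nat \<Rightarrow> int \<Rightarrow> real) \<Rightarrow> nat \<Rightarrow> (param \<Rightarrow> real) \<Rightarrow> int \<Rightarrow> real" where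
  "ar_error y x k \<theta> t = y t - (\<theta> (\<beta> 0) + (\<Sum>j=1..k. x j t * \<theta> (\<beta> j)))"

text \<open>Right-hand sides of the volatility equations at time \<open>t\<close>, as functions of the error path \<open>e\<close>
  and the path \<open>v\<close> of the squared scales \<open>\<sigma>\<^sub>s\<^sup>2\<close>; only times before \<open>t\<close> are used.\<close>

definition arch_rhs ::
    "nat \<Rightarrow> (param \<Rightarrow> real) \<Rightarrow> (int \<Rightarrow> real) \<Rightarrow> (int \<Rightarrow> real) \<Rightarrow> int \<Rightarrow> real" where
  "arch_rhs p \<theta> e v t = \<theta> (\<alpha> 0) + (\<Sum>i=1..p. \<theta> (\<alpha> i) * (e (t - int i))\<^sup>2)"

definition garch_rhs ::
    "nat \<Rightarrow> nat \<Rightarrow> (param \<Rightarrow> real) \<Rightarrow> (int \<Rightarrow> real) \<Rightarrow> (int \<Rightarrow> real) \<Rightarrow> int \<Rightarrow> real" where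
  "garch_rhs p q \<theta> e v t =
     \<theta> (\<alpha> 0) + (\<Sum>i=1..p. \<theta> (\<alpha> i) * (e (t - int i))\<^sup>2) + (\<Sum>i=1..q. \<theta> (\<gamma> i) * v (t - int i))"

definition tgarch_rhs ::
    "nat \<Rightarrow> nat \<Rightarrow> (param \<Rightarrow> real) \<Rightarrow> (int \<Rightarrow> real) \<Rightarrow> (int \<Rightarrow> real) \<Rightarrow> int \<Rightarrow> real" where
  "tgarch_rhs p q \<theta> e v t =
     \<theta> (\<alpha> 0) + (\<Sum>i=1..p. \<theta> (\<alpha> i) * (e (t - int i))\<^sup>2) + (\<Sum>i=1..q. \<theta> (\<gamma> i) * v (t - int i))
     + (\<Sum>i=1..p. \<theta> (\<delta> i) * (if e (t - int i) < 0 then 1 else 0) * (e (t - int i))\<^sup>2)"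

text \<open>\<open>Eh\<close> is the value of the constant \<open>E(h)\<close>.\<close>

definition egarch_rhs ::
    "real \<Rightarrow> nat \<Rightarrow> nat \<Rightarrow> (param \<Rightarrow> real) \<Rightarrow> (int \<Rightarrow> real) \<Rightarrow> (int \<Rightarrow> real) \<Rightarrow> int \<Rightarrow> real" where
  "egarch_rhs Eh p q \<theta> e v t =
     exp (\<theta> (\<alpha> 0)
          + (\<Sum>i=1..p. \<theta> (\<alpha> i) * (\<bar>e (t - int i) / sqrt (v (t - int i))\<bar> - Eh))
          + (\<Sum>i=1..q. \<theta> (\<gamma> i) * (e (t - int i) / sqrt (v (t - int i))))
          + (\<Sum>i=1..p. \<theta> (\<delta> i) * ln (v (t - int i))))"

text \<open>The path that agrees with the known path \<open>v0\<close> at times \<open>\<le> 0\<close> and is computed recursively from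
  the volatility equation at times \<open>1, \<dots>, n\<close>.\<close>

primrec volatility ::
    "((int \<Rightarrow> real) \<Rightarrow> int \<Rightarrow> real) \<Rightarrow> (int \<Rightarrow> real) \<Rightarrow> nat \<Rightarrow> int \<Rightarrow> real" where
  "volatility F v0 0 = v0"
| "volatility F v0 (Suc n) = (volatility F v0 n)(int (Suc n) := F (volatility F v0 n) (int (Suc n)))"

definition admissible ::
    "param set \<Rightarrow> nat \<Rightarrow> ((param \<Rightarrow> real) \<Rightarrow> int \<Rightarrow> real) \<Rightarrow> (param \<Rightarrow> real) set" where
  "admissible I T v = {\<theta> \<in> I \<rightarrow>\<^sub>E UNIV. \<forall>t\<in>{1..int T}. 0 < v \<theta> t}"

end

theory Submission
  imports Defs
begin

text \<open>The dependent likelihood is the elliptical density itself: a diagonal scale matrix has the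
  product of its entries as determinant and the reciprocals of its entries as inverse, so the
  quadratic form becomes a weighted sum of squares (\<open>elliptical_density_diag_matrix\<close>). The
  independent likelihood is the product of univariate densities; that this product is the density
  of the random vector follows by comparing the two measures on boxes, where both independence and
  Lebesgue measure factor over the coordinates (\<open>distributed_vec_indep_vars\<close>). In both cases the
  constant in the density of the given variables is the prescribed one, because the normalization
  identity is linear in the constant and hence determines it.

  The volatility models enter in two ways only. The right-hand side of each volatility equation
  reads the scale path strictly before the current time, so the path computed step by step solves
  the equation throughout the sample (\<open>volatility_equation\<close>). On admissible parameters all sample
  scales are positive; there both likelihoods have the closed forms above and are nonnegative. Since
  the extended logarithm is strictly increasing on the nonnegative reals, the logarithm of a
  likelihood has the same maximizers as the likelihood
  (\<open>objective_function_log_ext\<close>).\<close>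


section \<open>Elliptical densities with diagonal scale matrix\<close>

lemma matrix_inv_eqI:
  fixes A B :: "real^'n^'n"
  assumes "A ** B = mat 1"
  shows "matrix_inv A = B"
proof -
  have "A ** matrix_inv A = mat 1 \<and> matrix_inv A ** A = mat 1"
    unfolding matrix_inv_def
    by (rule someI[of _ B]) (use assms matrix_left_right_inverse in blast)
  then have "matrix_inv A = matrix_inv A ** (A ** B)"
    using assms by simp
  also have "\<dots> = B"
    using \<open>A ** matrix_inv A = mat 1 \<and> matrix_inv A ** A = mat 1\<close>
    by (simp add: matrix_mul_assoc)
  finally show ?thesis .
qed

lemma diag_matrix_mult_vec:
  fixes d z :: "real^'n"
  shows "diag_matrix d *v z = (\<chi> i. d $ i * z $ i)"
proof -
  have "(if i = j then d $ i else 0) * z $ j = (if i = j then d $ i * z $ i else 0)" for i j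
    by simp
  then show ?thesis
    by (simp add: diag_matrix_def matrix_vector_mult_def vec_eq_iff)
qed

lemma diag_matrix_mult:
  fixes a b :: "real^'n"
  shows "diag_matrix a ** diag_matrix b = diag_matrix (\<chi> i. a $ i * b $ i)"
proof -
  have "(if i = k then a $ i else 0) * (if k = j then b $ k else 0)
      = (if i = k then if i = j then a $ i * b $ i else 0 else 0)" for i j k
    by simp
  then show ?thesis
    by (simp add: diag_matrix_def matrix_matrix_mult_def vec_eq_iff)
qed

lemma diag_matrix_one: "diag_matrix (\<chi> i. 1) = (mat 1 :: real^'n^'n)"
  by (simp add: diag_matrix_def mat_def vec_eq_iff)

lemma matrix_inv_diag_matrix:
  fixes s :: "real^'n"
  assumes "\<And>t. s $ t \<noteq> 0"
  shows "matrix_inv (diag_matrix s) = diag_matrix (\<chi> t. 1 / s $ t)"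
  by (rule matrix_inv_eqI) (simp add: diag_matrix_mult assms flip: diag_matrix_one)

lemma det_diag_matrix:
  fixes s :: "real^'n"
  shows "det (diag_matrix s) = (\<Prod>t\<in>UNIV. s $ t)"
  by (subst det_diagonal) (simp_all add: diag_matrix_def)

lemma elliptical_density_diag_matrix:
  fixes s z :: "real^'n"
  assumes "\<And>t. 0 < s $ t"
  shows "elliptical_density c 0 (diag_matrix s) h z
    = c / (\<Prod>t\<in>UNIV. s $ t) powr (1/2) * h (\<Sum>t\<in>UNIV. (z $ t)\<^sup>2 / s $ t)"
proof -
  have "s $ t \<noteq> 0" for t
    using assms[of t] by simp
  then have "z \<bullet> (matrix_inv (diag_matrix s) *v z) = (\<Sum>t\<in>UNIV. (z $ t)\<^sup>2 / s $ t)"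
    by (simp add: matrix_inv_diag_matrix diag_matrix_mult_vec inner_vec_def power2_eq_square)
  then show ?thesis
    by (simp add: elliptical_density_def det_diag_matrix powr_minus_divide)
qed

lemma prod_elliptical_density1:
  fixes s z :: "real^'n"
  shows "(\<Prod>t\<in>UNIV. elliptical_density1 c 0 (s $ t) h (z $ t))
    = c ^ CARD('n) / (\<Prod>t\<in>UNIV. s $ t) powr (1/2) * (\<Prod>t\<in>UNIV. h ((z $ t)\<^sup>2 / s $ t))"
  by (simp add: elliptical_density1_def prod.distrib prod_dividef prod_powr_distrib
      powr_minus_divide)


section \<open>Normalizing constants\<close>

lemma generator_nonneg: "generator m h \<Longrightarrow> 0 \<le> u \<Longrightarrow> 0 \<le> h u"
  by (simp add: generator_def)

lemma pos_def_mat_1: "pos_def (mat 1 :: real^'n^'n)"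
  by (simp add: pos_def_def transpose_mat)

lemma elliptical_density_scale:
  "elliptical_density c \<mu> \<Sigma> h z = c * elliptical_density 1 \<mu> \<Sigma> h z"
  by (simp add: elliptical_density_def)

lemma elliptical_density1_scale:
  "elliptical_density1 c \<mu> s h z = c * elliptical_density1 1 \<mu> s h z"
  by (simp add: elliptical_density1_def)

text \<open>Specializing to the standard location and scale exhibits the constant as the reciprocal of one
  fixed integral. This identity yields both its uniqueness and its sign.\<close>

lemma normalizing_const_standard:
  assumes "normalizing_const TYPE('n::finite) h c"
  shows "c * (\<integral>z. elliptical_density 1 (0 :: real^'n) (mat 1) h z \<partial>lborel) = 1"
proof -
  have "(\<integral>z. elliptical_density c (0 :: real^'n) (mat 1) h z \<partial>lborel) = 1"
    using assms pos_def_mat_1 unfolding normalizing_const_def by blast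
  then show ?thesis
    by (subst (asm) elliptical_density_scale) simp
qed

lemma normalizing_const1_standard:
  assumes "normalizing_const1 h c"
  shows "c * (\<integral>z. elliptical_density1 1 0 1 h z \<partial>lborel) = 1"
proof -
  have "(\<integral>z. elliptical_density1 c 0 1 h z \<partial>lborel) = 1"
    using assms unfolding normalizing_const1_def by simp
  then show ?thesis
    by (subst (asm) elliptical_density1_scale) simp
qed

lemma normalizing_const_unique:
  assumes "normalizing_const TYPE('n::finite) h c" "normalizing_const TYPE('n) h c'"
  shows "c = c'"
  using assms[THEN normalizing_const_standard] by (metis mult_cancel_right mult_zero_right zero_neq_one)

lemma normalizing_const1_unique:
  assumes "normalizing_const1 h c" "normalizing_const1 h c'"
  shows "c = c'"
  using assms[THEN normalizing_const1_standard] by (metis mult_cancel_right mult_zero_right zero_neq_one)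

text \<open>The integral of the unnormalized density is nonnegative, so its reciprocal is nonnegative too.\<close>

lemma normalizing_const_nonneg:
  assumes "normalizing_const TYPE('n::finite) h c" "generator m h"
  shows "0 \<le> c"
proof -
  have "0 \<le> elliptical_density 1 (0 :: real^'n) (mat 1) h z" for z
    using generator_nonneg[OF assms(2)]
    by (simp add: elliptical_density_diag_matrix sum_nonneg flip: diag_matrix_one)
  then have "0 \<le> (\<integral>z. elliptical_density 1 (0 :: real^'n) (mat 1) h z \<partial>lborel)"
    by (rule Bochner_Integration.integral_nonneg)
  then show ?thesis
    using normalizing_const_standard[OF assms(1)]
    by (metis linorder_not_le mult_nonneg_nonpos2 less_imp_le mult.commute not_one_le_zero)
qed

lemma normalizing_const1_nonneg:
  assumes "normalizing_const1 h c" "generator m h"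
  shows "0 \<le> c"
proof -
  have "0 \<le> elliptical_density1 1 0 1 h z" for z
    using generator_nonneg[OF assms(2)] by (simp add: elliptical_density1_def)
  then have "0 \<le> (\<integral>z. elliptical_density1 1 0 1 h z \<partial>lborel)"
    by (rule Bochner_Integration.integral_nonneg)
  then show ?thesis
    using normalizing_const1_standard[OF assms(1)]
    by (metis linorder_not_le mult_nonneg_nonpos2 less_imp_le mult.commute not_one_le_zero)
qed

lemma elliptical_density_diag_matrix_nonneg:
  fixes s :: "real^'n"
  assumes "normalizing_const TYPE('n) h c" "generator m h" "\<And>t. 0 < s $ t"
  shows "0 \<le> elliptical_density c 0 (diag_matrix s) h z"
  using normalizing_const_nonneg[OF assms(1,2)] generator_nonneg[OF assms(2)] assms(3)
  by (simp add: elliptical_density_diag_matrix sum_nonneg less_imp_le)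

lemma elliptical_density1_nonneg:
  assumes "normalizing_const1 h c" "generator m h" "0 < s"
  shows "0 \<le> elliptical_density1 c \<mu> s h z"
  using normalizing_const1_nonneg[OF assms(1,2)] generator_nonneg[OF assms(2)] assms(3)
  by (simp add: elliptical_density1_def)

text \<open>The distribution predicate only asserts that some normalizing constant exists; by uniqueness it
  is the given one.\<close>

lemma elliptical_distributed:
  assumes "elliptical M X \<mu> \<Sigma> h" "normalizing_const TYPE('n::finite) h c"
  shows "distributed M lborel X (\<lambda>z :: real^'n. ennreal (elliptical_density c \<mu> \<Sigma> h z))"
  using assms normalizing_const_unique unfolding elliptical_def by blast

lemma elliptical1_distributed:
  assumes "elliptical1 M X \<mu> s h" "normalizing_const1 h c"
  shows "distributed M lborel X (\<lambda>z. ennreal (elliptical_density1 c \<mu> s h z))"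
  using assms normalizing_const1_unique unfolding elliptical1_def by blast


section \<open>Joint density of independent variables\<close>

lemma bij_betw_axis_Basis: "bij_betw (\<lambda>i. axis i 1) UNIV (Basis :: (real^'n) set)"
  unfolding bij_betw_def
  by (auto simp: inj_on_def axis_eq_axis Basis_vec_def)

lemma borel_measurable_vec_nth: "(\<lambda>z :: real^'n. z $ i) \<in> borel_measurable borel"
  by (intro borel_measurable_continuous_onI continuous_intros)

lemma borel_measurable_vec_lambda:
  fixes X :: "'n::finite \<Rightarrow> 'a \<Rightarrow> real"
  assumes "\<And>i. X i \<in> borel_measurable M"
  shows "(\<lambda>\<omega>. \<chi> i. X i \<omega>) \<in> borel_measurable M"
proof -
  have "(\<lambda>\<omega>. (\<chi> i. X i \<omega>) \<bullet> b) \<in> borel_measurable M" if "b \<in> Basis" for b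
    using that assms by (auto simp: Basis_vec_def inner_axis)
  then show ?thesis
    by (subst borel_measurable_euclidean_space) blast
qed

text \<open>Tonelli's theorem for products of functions of one coordinate each, with the coordinates indexed
  by \<open>'n\<close> instead of the standard basis.\<close>

lemma nn_integral_lborel_vec_prod:
  fixes g :: "'n::finite \<Rightarrow> real \<Rightarrow> ennreal"
  assumes "\<And>i. g i \<in> borel_measurable borel"
  shows "(\<integral>\<^sup>+z. (\<Prod>i\<in>UNIV. g i (z $ i)) \<partial>lborel) = (\<Prod>i\<in>UNIV. \<integral>\<^sup>+u. g i u \<partial>lborel)"
proof -
  have *: "(\<Prod>b\<in>(Basis :: (real^'n) set). k b) = (\<Prod>i\<in>UNIV. k (axis i 1))"
    for k :: "real^'n \<Rightarrow> ennreal"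
    by (rule prod.reindex_bij_betw[OF bij_betw_axis_Basis, symmetric])
  have "(\<integral>\<^sup>+z. (\<Prod>b\<in>Basis. g (axis_index b) (z \<bullet> b)) \<partial>(lborel :: (real^'n) measure))
      = (\<Prod>b\<in>(Basis :: (real^'n) set). \<integral>\<^sup>+u. g (axis_index b) u \<partial>lborel)"
    by (rule nn_integral_lborel_prod) (simp_all add: assms)
  then show ?thesis
    by (simp add: * inner_axis)
qed

text \<open>Boxes form an intersection-stable generator of the Borel sets, so the law of the vector and the
  measure with the product density agree once they agree on boxes. On a box, the former factors by
  independence and the latter by Tonelli, into the same one-dimensional probabilities.\<close>

lemma (in prob_space) distributed_vec_indep_vars:
  fixes X :: "'n::finite \<Rightarrow> 'a \<Rightarrow> real" and f :: "'n \<Rightarrow> real \<Rightarrow> ennreal"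
  assumes indep: "indep_vars (\<lambda>_. borel) X UNIV"
    and dist: "\<And>i. distributed M lborel (X i) (f i)"
  shows "distributed M lborel (\<lambda>\<omega>. \<chi> i. X i \<omega>) (\<lambda>z. \<Prod>i\<in>UNIV. f i (z $ i))"
proof -
  have X [measurable]: "X i \<in> borel_measurable M" for i
    using distributed_measurable[OF dist] by simp
  have f [measurable]: "f i \<in> borel_measurable borel" for i
    using distributed_borel_measurable[OF dist] by simp
  note borel_measurable_vec_nth [measurable]
  define V where "V \<omega> = (\<chi> i. X i \<omega>)" for \<omega>
  define F where "F z = (\<Prod>i\<in>UNIV. f i (z $ i))" for z :: "real^'n"
  have V [measurable]: "V \<in> borel_measurable M"
    unfolding V_def[abs_def] by (rule borel_measurable_vec_lambda) (rule X)
  have F [measurable]: "F \<in> borel_measurable borel"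
    unfolding F_def[abs_def] by measurable
  have box: "emeasure (distr M lborel V) (box l u) = emeasure (density lborel F) (box l u)" for l u
  proof -
    let ?A = "\<lambda>i. {l $ i <..< u $ i}"
    have "V -` box l u \<inter> space M = (\<Inter>i\<in>UNIV. X i -` ?A i \<inter> space M)"
      by (auto simp: V_def mem_box_cart)
    then have "emeasure (distr M lborel V) (box l u) = ennreal (prob (\<Inter>i\<in>UNIV. X i -` ?A i \<inter> space M))"
      by (simp add: emeasure_distr emeasure_eq_measure)
    also have "\<dots> = ennreal (\<Prod>i\<in>UNIV. prob (X i -` ?A i \<inter> space M))"
      by (subst indep_varsD_finite[OF indep]) simp_all
    also have "\<dots> = (\<Prod>i\<in>UNIV. emeasure M (X i -` ?A i \<inter> space M))"
      by (simp add: emeasure_eq_measure prod_ennreal)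
    also have "\<dots> = (\<Prod>i\<in>UNIV. emeasure (density lborel (f i)) (?A i))"
      by (simp add: emeasure_distr flip: distributed_distr_eq_density[OF dist])
    also have "\<dots> = (\<Prod>i\<in>UNIV. \<integral>\<^sup>+v. f i v * indicator (?A i) v \<partial>lborel)"
      by (simp add: emeasure_density)
    also have "\<dots> = (\<integral>\<^sup>+z. (\<Prod>i\<in>UNIV. f i (z $ i) * indicator (?A i) (z $ i)) \<partial>lborel)"
      by (rule nn_integral_lborel_vec_prod[symmetric]) measurable
    also have "\<dots> = (\<integral>\<^sup>+z. F z * indicator (box l u) z \<partial>lborel)"
    proof (rule nn_integral_cong)
      fix z :: "real^'n"
      have "(\<Prod>i\<in>UNIV. indicator (?A i) (z $ i)) = (indicator (box l u) z :: ennreal)"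
        by (auto simp: indicator_def mem_box_cart)
      then show "(\<Prod>i\<in>UNIV. f i (z $ i) * indicator (?A i) (z $ i)) = F z * indicator (box l u) z"
        by (simp add: prod.distrib F_def)
    qed
    also have "\<dots> = emeasure (density lborel F) (box l u)"
      by (simp add: emeasure_density)
    finally show ?thesis .
  qed
  have "distr M lborel V = density lborel F"
  proof (rule measure_eqI_generator_eq)
    let ?E = "range (\<lambda>(a, b). box a b :: (real^'n) set)"
    let ?B = "\<lambda>n::nat. box (- (real n *\<^sub>R One)) (real n *\<^sub>R One) :: (real^'n) set"
    show "Int_stable ?E"
      by (auto simp: Int_stable_def box_Int_box)
    show "?E \<subseteq> Pow UNIV" "sets (distr M lborel V) = sigma_sets UNIV ?E"
      "sets (density lborel F) = sigma_sets UNIV ?E"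
      by (simp_all add: borel_eq_box)
    show "range ?B \<subseteq> ?E" "(\<Union>i. ?B i) = UNIV"
      unfolding UN_box_eq_UNIV by auto
    show "emeasure (distr M lborel V) (?B i) \<noteq> \<infinity>" for i
      by (simp add: emeasure_distr emeasure_eq_measure)
    show "emeasure (distr M lborel V) A = emeasure (density lborel F) A" if "A \<in> ?E" for A
      using that box by auto
  qed
  then show ?thesis
    unfolding distributed_def using V F by (simp add: V_def[abs_def] F_def[abs_def])
qed


section \<open>Maximizing the log-likelihood\<close>

text \<open>Nonnegativity matters: all negative numbers and 0 are sent to \<open>-\<infinity>\<close>, so the extended logarithm
  does not separate values below 0.\<close>

lemma log_ext_less_iff:
  assumes "0 \<le> a" "0 \<le> b"
  shows "log_ext a < log_ext b \<longleftrightarrow> a < b"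
  using assms by (auto simp: log_ext_def)

lemma objective_function_log_ext:
  assumes "\<And>\<theta>. \<theta> \<in> \<Theta> \<Longrightarrow> 0 \<le> L \<theta>" "\<And>\<theta>. \<theta> \<in> \<Theta> \<Longrightarrow> L' \<theta> = L \<theta>"
  shows "objective_function \<Theta> L (\<lambda>\<theta>. log_ext (L' \<theta>))"
  using assms unfolding objective_function_def is_arg_max_def
  by (auto simp: log_ext_less_iff)

lemma objective_function_elliptical:
  fixes s z :: "'p \<Rightarrow> real^'n"
  assumes "\<And>\<theta> t. \<theta> \<in> \<Theta> \<Longrightarrow> 0 < s \<theta> $ t" "generator m h" "normalizing_const TYPE('n) h c"
  shows "objective_function \<Theta>
    (\<lambda>\<theta>. elliptical_density c 0 (diag_matrix (s \<theta>)) h (z \<theta>))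
    (\<lambda>\<theta>. log_ext (c / (\<Prod>t\<in>UNIV. s \<theta> $ t) powr (1/2) * h (\<Sum>t\<in>UNIV. (z \<theta> $ t)\<^sup>2 / s \<theta> $ t)))"
  using assms
  by (intro objective_function_log_ext elliptical_density_diag_matrix_nonneg
      elliptical_density_diag_matrix[symmetric])

lemma objective_function_elliptical1:
  fixes s z :: "'p \<Rightarrow> real^'n"
  assumes "\<And>\<theta> t. \<theta> \<in> \<Theta> \<Longrightarrow> 0 < s \<theta> $ t" "generator m h" "normalizing_const1 h c"
  shows "objective_function \<Theta>
    (\<lambda>\<theta>. \<Prod>t\<in>UNIV. elliptical_density1 c 0 (s \<theta> $ t) h (z \<theta> $ t))
    (\<lambda>\<theta>. log_ext (c ^ CARD('n) / (\<Prod>t\<in>UNIV. s \<theta> $ t) powr (1/2)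
       * (\<Prod>t\<in>UNIV. h ((z \<theta> $ t)\<^sup>2 / s \<theta> $ t))))"
  using assms
  by (intro objective_function_log_ext prod_nonneg elliptical_density1_nonneg
      prod_elliptical_density1[symmetric])


section \<open>Volatility recursions\<close>

definition causal :: "((int \<Rightarrow> real) \<Rightarrow> int \<Rightarrow> real) \<Rightarrow> bool" where
  "causal F \<longleftrightarrow> (\<forall>v w t. (\<forall>s<t. v s = w s) \<longrightarrow> F v t = F w t)"

lemma volatility_stable:
  assumes "s \<le> int m" "m \<le> n"
  shows "volatility F v0 n s = volatility F v0 m s"
  using assms(2,1) by (induction n rule: dec_induct) auto

text \<open>The value at time \<open>t\<close> is computed from the path known after \<open>t - 1\<close> steps. That path agrees with
  the final one before \<open>t\<close>, and causality makes the difference from \<open>t\<close> on irrelevant.\<close>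

lemma volatility_equation:
  assumes "causal F" "t \<in> {1..int n}"
  shows "volatility F v0 n t = F (volatility F v0 n) t"
proof -
  obtain m where m: "t = int (Suc m)" "Suc m \<le> n"
    using assms(2) that[of "nat t - 1"] by auto
  have "volatility F v0 n t = volatility F v0 (Suc m) t"
    using m by (intro volatility_stable) auto
  also have "\<dots> = F (volatility F v0 m) t"
    using m by simp
  also have "\<dots> = F (volatility F v0 n) t"
  proof -
    have "\<forall>s<t. volatility F v0 m s = volatility F v0 n s"
      using m by (auto intro!: volatility_stable[symmetric])
    then show ?thesis
      using assms(1) unfolding causal_def by blast
  qed
  finally show ?thesis .
qed

lemma causal_rhs:
  shows causal_arch_rhs: "causal (arch_rhs p \<theta> e)"
    and causal_garch_rhs: "causal (garch_rhs p q \<theta> e)"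
    and causal_tgarch_rhs: "causal (tgarch_rhs p q \<theta> e)"
    and causal_egarch_rhs: "causal (egarch_rhs Eh p q \<theta> e)"
  by (auto simp: causal_def arch_rhs_def garch_rhs_def tgarch_rhs_def egarch_rhs_def
      cong: sum.cong_simp)

lemmas volatility_arch = trans[OF volatility_equation[OF causal_arch_rhs] arch_rhs_def]
  and volatility_garch = trans[OF volatility_equation[OF causal_garch_rhs] garch_rhs_def]
  and volatility_tgarch = trans[OF volatility_equation[OF causal_tgarch_rhs] tgarch_rhs_def]
  and volatility_egarch = trans[OF volatility_equation[OF causal_egarch_rhs] egarch_rhs_def]


section \<open>Parameter counts\<close>

lemma card_arch_params: "card (arch_params k p) = k + 1 + p + 1"
  unfolding arch_params_def by (subst card_Un_disjoint) (auto simp: card_image inj_on_def)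

lemma card_garch_params: "card (garch_params k p q) = k + 1 + p + 1 + q"
proof -
  have "garch_params k p q = arch_params k p \<union> \<gamma> ` {1..q}"
    by (simp add: garch_params_def arch_params_def)
  moreover have "finite (arch_params k p)" "arch_params k p \<inter> \<gamma> ` {1..q} = {}"
    by (auto simp: arch_params_def)
  ultimately show ?thesis
    by (simp add: card_Un_disjoint card_arch_params card_image inj_on_def)
qed

lemma card_tgarch_params: "card (tgarch_params k p q) = k + 1 + p + 1 + q + p"
proof -
  have "tgarch_params k p q = garch_params k p q \<union> \<delta> ` {1..p}"
    by (simp add: tgarch_params_def garch_params_def)
  moreover have "finite (garch_params k p q)" "garch_params k p q \<inter> \<delta> ` {1..p} = {}"
    by (auto simp: garch_params_def)
  ultimately show ?thesis
    by (simp add: card_Un_disjoint card_garch_params card_image inj_on_def)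
qed


section \<open>The likelihoods of the volatility models\<close>

theorem theorem2p1:
  fixes h :: "real \<Rightarrow> real" and cT c1 :: real and T :: nat
    and \<sigma>2 :: "real^'n"
    and M :: "'a measure" and \<epsilon> :: "'a \<Rightarrow> real^'n"
    and M' :: "'b measure" and \<epsilon>' :: "'n \<Rightarrow> 'b \<Rightarrow> real"
    and time :: "'n \<Rightarrow> int"
    and y v0 :: "int \<Rightarrow> real" and x :: "nat \<Rightarrow> int \<Rightarrow> real"
    and k p q :: nat and E :: "(real \<Rightarrow> real) \<Rightarrow> real"
  assumes T: "T = CARD('n)"
    and time: "bij_betw time UNIV {1..int T}"
    and presample: "\<forall>t\<le>0. 0 < v0 t"
  shows
   "let
      LD = (\<lambda>(s :: real^'n) (e :: real^'n).
              cT / (\<Prod>t\<in>UNIV. s $ t) powr (1/2) * h (\<Sum>t\<in>UNIV. (e $ t)\<^sup>2 / s $ t));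
      LI = (\<lambda>(s :: real^'n) (e :: real^'n).
              c1 ^ T / (\<Prod>t\<in>UNIV. s $ t) powr (1/2) * (\<Prod>t\<in>UNIV. h ((e $ t)\<^sup>2 / s $ t)));
      sample = (\<lambda>(u :: int \<Rightarrow> real). (\<chi> t. u (time t)) :: real^'n);
      e = ar_error y x k;
      objectives = (\<lambda>(\<Theta> :: (param \<Rightarrow> real) set) (v :: (param \<Rightarrow> real) \<Rightarrow> int \<Rightarrow> real).
        (generator T h \<and> normalizing_const TYPE('n) h cT \<longrightarrow>
           objective_function \<Theta>
             (\<lambda>\<theta>. elliptical_density cT 0 (diag_matrix (sample (v \<theta>))) h (sample (e \<theta>)))
             (\<lambda>\<theta>. log_ext (LD (sample (v \<theta>)) (sample (e \<theta>))))) \<and>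
        (generator 1 h \<and> normalizing_const1 h c1 \<longrightarrow>
           objective_function \<Theta>
             (\<lambda>\<theta>. \<Prod>t\<in>UNIV. elliptical_density1 c1 0 (sample (v \<theta>) $ t) h (sample (e \<theta>) $ t))
             (\<lambda>\<theta>. log_ext (LI (sample (v \<theta>)) (sample (e \<theta>))))))
    in
      \<comment> \<open>(D)\<close>
      ((\<forall>t. 0 < \<sigma>2 $ t) \<and> normalizing_const TYPE('n) h cT \<and>
       prob_space M \<and> elliptical M \<epsilon> 0 (diag_matrix \<sigma>2) h \<longrightarrow>
         (\<forall>z. elliptical_density cT 0 (diag_matrix \<sigma>2) h z = LD \<sigma>2 z) \<and>
         distributed M lborel \<epsilon> (\<lambda>z. ennreal (LD \<sigma>2 z))) \<and>
      \<comment> \<open>(I)\<close>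
      ((\<forall>t. 0 < \<sigma>2 $ t) \<and> normalizing_const1 h c1 \<and>
       prob_space M' \<and> prob_space.indep_vars M' (\<lambda>_. borel) \<epsilon>' UNIV \<and>
       (\<forall>t. elliptical1 M' (\<epsilon>' t) 0 (\<sigma>2 $ t) h) \<longrightarrow>
         (\<forall>z. (\<Prod>t\<in>UNIV. elliptical_density1 c1 0 (\<sigma>2 $ t) h (z $ t)) = LI \<sigma>2 z) \<and>
         distributed M' lborel (\<lambda>\<omega>. \<chi> t. \<epsilon>' t \<omega>) (\<lambda>z. ennreal (LI \<sigma>2 z))) \<and>
      \<comment> \<open>Arch(p)\<close>
      (let v = (\<lambda>\<theta>. volatility (arch_rhs p \<theta> (e \<theta>)) v0 T);
           \<Theta> = admissible (arch_params k p) T v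
       in card (arch_params k p) = k + 1 + p + 1 \<and>
          (\<forall>\<theta>\<in>\<Theta>. \<forall>t\<in>{1..int T}.
             v \<theta> t = \<theta> (\<alpha> 0) + (\<Sum>i=1..p. \<theta> (\<alpha> i) * (e \<theta> (t - int i))\<^sup>2)) \<and>
          objectives \<Theta> v) \<and>
      \<comment> \<open>Garch(p,q)\<close>
      (let v = (\<lambda>\<theta>. volatility (garch_rhs p q \<theta> (e \<theta>)) v0 T);
           \<Theta> = admissible (garch_params k p q) T v
       in card (garch_params k p q) = k + 1 + p + 1 + q \<and>
          (\<forall>\<theta>\<in>\<Theta>. \<forall>t\<in>{1..int T}.
             v \<theta> t = \<theta> (\<alpha> 0) + (\<Sum>i=1..p. \<theta> (\<alpha> i) * (e \<theta> (t - int i))\<^sup>2)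
               + (\<Sum>i=1..q. \<theta> (\<gamma> i) * v \<theta> (t - int i))) \<and>
          objectives \<Theta> v) \<and>
      \<comment> \<open>Tgarch(p,q)\<close>
      (let v = (\<lambda>\<theta>. volatility (tgarch_rhs p q \<theta> (e \<theta>)) v0 T);
           \<Theta> = admissible (tgarch_params k p q) T v
       in card (tgarch_params k p q) = k + 1 + p + 1 + q + p \<and>
          (\<forall>\<theta>\<in>\<Theta>. \<forall>t\<in>{1..int T}.
             v \<theta> t = \<theta> (\<alpha> 0) + (\<Sum>i=1..p. \<theta> (\<alpha> i) * (e \<theta> (t - int i))\<^sup>2)
               + (\<Sum>i=1..q. \<theta> (\<gamma> i) * v \<theta> (t - int i))
               + (\<Sum>i=1..p. \<theta> (\<delta> i) * (if e \<theta> (t - int i) < 0 then 1 else 0)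
                             * (e \<theta> (t - int i))\<^sup>2)) \<and>
          objectives \<Theta> v) \<and>
      \<comment> \<open>Egarch(p,q)\<close>
      (let v = (\<lambda>\<theta>. volatility (egarch_rhs (E h) p q \<theta> (e \<theta>)) v0 T);
           \<Theta> = admissible (egarch_params k p q) T v
       in card (egarch_params k p q) = k + 1 + p + 1 + q + p \<and>
          (\<forall>\<theta>\<in>\<Theta>. \<forall>t\<in>{1..int T}.
             v \<theta> t = exp (\<theta> (\<alpha> 0)
               + (\<Sum>i=1..p. \<theta> (\<alpha> i) * (\<bar>e \<theta> (t - int i) / sqrt (v \<theta> (t - int i))\<bar> - E h))
               + (\<Sum>i=1..q. \<theta> (\<gamma> i) * (e \<theta> (t - int i) / sqrt (v \<theta> (t - int i))))
               + (\<Sum>i=1..p. \<theta> (\<delta> i) * ln (v \<theta> (t - int i))))) \<and>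
          objectives \<Theta> v)"
proof -
  have in_sample: "time t \<in> {1..int T}" for t
    using time by (auto simp: bij_betw_def)
  have pos: "0 < (\<chi> t. v \<theta> (time t) :: real^'n) $ t"
    if "\<theta> \<in> admissible I T v" for I \<theta> t and v :: "(param \<Rightarrow> real) \<Rightarrow> int \<Rightarrow> real"
    using that in_sample by (simp add: admissible_def)
  \<comment> \<open>The objectives concern the observed errors and scales only through their values at the
    sample times, so one argument serves all four volatility models.\<close>
  note objective_D = objective_function_elliptical[OF pos]
  note objective_I = objective_function_elliptical1[OF pos, folded T]
  show ?thesis
    unfolding Let_def
  proof (intro conjI impI allI ballI, goal_cases)
    case (1 z)
    then show ?case
      by (intro elliptical_density_diag_matrix) blast
  next
    case 2
    then have "distributed M lborel \<epsilon> (\<lambda>z. ennreal (elliptical_density cT 0 (diag_matrix \<sigma>2) h z))"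
      by (blast intro: elliptical_distributed)
    with 2 show ?case
      by (simp add: elliptical_density_diag_matrix)
  next
    case (3 z)
    then show ?case
      unfolding T by (intro prod_elliptical_density1)
  next
    case 4
    then interpret prob_space M' by blast
    from 4 have "distributed M' lborel (\<epsilon>' t) (\<lambda>u. ennreal (elliptical_density1 c1 0 (\<sigma>2 $ t) h u))" for t
      by (blast intro: elliptical1_distributed)
    with 4 have "distributed M' lborel (\<lambda>\<omega>. \<chi> t. \<epsilon>' t \<omega>)
        (\<lambda>z. \<Prod>t\<in>UNIV. ennreal (elliptical_density1 c1 0 (\<sigma>2 $ t) h (z $ t)))"
      by (intro distributed_vec_indep_vars) blast+
    moreover have "0 \<le> elliptical_density1 c1 0 (\<sigma>2 $ t) h u" for t u
      using 4 elliptical1_def elliptical_density1_nonneg by blast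
    ultimately show ?case
      using 4 by (simp add: prod_ennreal prod_elliptical_density1 T)
  qed (rule card_arch_params card_garch_params card_tgarch_params
      volatility_arch volatility_garch volatility_tgarch volatility_egarch
      objective_D objective_I; (elim conjE)?; assumption)+
qed

end
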